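(* For every $1\le p<q<\infty$ one has $\ell^p_{q,1}(\mathbb Z)=\ell^1(\mathbb Z)$ with equivalence of norms. In particular, $$(\ell^p_{q,1}(\mathbb Z))^*=(\ell^1(\mathbb Z))^*=\ell^\infty(\mathbb Z).$$
   Context: For $j\in\mathbb N_0=\{0,1,2,\dots\}$ and $k\in\mathbb Z$ let $I(j,k)=[2^jk,2^j(k+1))\cap\mathbb Z$ (a discrete dyadic interval with $2^j$ elements). For a real sequence $x=(x(k))_{k\in\mathbb Z}$ put $$\|x\|_{\ell^p_{q,1}}=\sum_{j=0}^\infty\sum_{k\in\mathbb Z}(2^j)^{\frac1q-\frac1p}\Big(\sum_{l\in I(j,k)}|x(l)|^p\Big)^{1/p},$$ and let $\ell^p_{q,1}(\mathbb Z)$ be the space of all $x\in\mathbb R^{\mathbb Z}$ with $\|x\|_{\ell^p_{q,1}}<\infty$. The identification of dual spaces is via the pairing $\sum_{n}x(n)y(n)$, with equivalence of norms. *)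

theory Defs
  imports Complex_Main "HOL-Library.FuncSet" "HOL-Library.Extended_Nonnegative_Real"
    "HOL-Analysis.Infinite_Sum"
begin

type_synonym zseq = "int \<Rightarrow> real"

text \<open>
  Norms on sequence spaces are extended norms: functions on all of \<open>\<real>\<^sup>\<int>\<close> with values in
  \<^typ>\<open>ennreal\<close>.  The space belonging to an extended norm is the set where it is finite.  The
  sums defining the norms take values in \<^typ>\<open>ennreal\<close>, so that a divergent one is \<open>\<infinity>\<close> and not a
  junk value.
\<close>

definition space_of :: "(zseq \<Rightarrow> ennreal) \<Rightarrow> zseq set" where
  "space_of N = {x. N x < \<infinity>}"

definition dyadic :: "nat \<Rightarrow> int \<Rightarrow> int set" where
  "dyadic j k = {2 ^ j * k ..< 2 ^ j * (k + 1)}"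

definition lpq1_norm :: "real \<Rightarrow> real \<Rightarrow> zseq \<Rightarrow> ennreal" where
  "lpq1_norm p q x =
     (\<Sum>j::nat. \<Sum>\<^sub>\<infinity>k::int.
        ennreal ((2 ^ j) powr (1 / q - 1 / p) * (\<Sum>l\<in>dyadic j k. \<bar>x l\<bar> powr p) powr (1 / p)))"

definition l1_norm :: "zseq \<Rightarrow> ennreal" where
  "l1_norm x = (\<Sum>\<^sub>\<infinity>n::int. ennreal \<bar>x n\<bar>)"

definition linf_norm :: "zseq \<Rightarrow> ennreal" where
  "linf_norm y = (SUP n::int. ennreal \<bar>y n\<bar>)"

definition eq_with_equiv_norms ::
    "'a set \<Rightarrow> ('a \<Rightarrow> ennreal) \<Rightarrow> 'a set \<Rightarrow> ('a \<Rightarrow> ennreal) \<Rightarrow> bool" where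
  "eq_with_equiv_norms A N B M \<longleftrightarrow>
     A = B \<and>
     (\<exists>c C::real. 0 < c \<and> 0 < C \<and>
        (\<forall>x\<in>A. ennreal c * M x \<le> N x \<and> N x \<le> ennreal C * M x))"

text \<open>
  The bounded linear functionals on \<open>space_of N\<close>.  Extensionality (a fixed junk value outside
  the space) makes equality of functionals coincide with equality on the space.
\<close>

definition dual_space :: "(zseq \<Rightarrow> ennreal) \<Rightarrow> (zseq \<Rightarrow> real) set" where
  "dual_space N =
     {f \<in> extensional (space_of N).
        (\<forall>x\<in>space_of N. \<forall>y\<in>space_of N. f (\<lambda>n. x n + y n) = f x + f y) \<and>
        (\<forall>a. \<forall>x\<in>space_of N. f (\<lambda>n. a * x n) = a * f x) \<and>
        (\<exists>C::real. \<forall>x\<in>space_of N. ennreal \<bar>f x\<bar> \<le> ennreal C * N x)}"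

definition dual_norm :: "(zseq \<Rightarrow> ennreal) \<Rightarrow> (zseq \<Rightarrow> real) \<Rightarrow> ennreal" where
  "dual_norm N f = (SUP x\<in>{x. N x \<le> 1}. ennreal \<bar>f x\<bar>)"

definition pairing_functional :: "(zseq \<Rightarrow> ennreal) \<Rightarrow> zseq \<Rightarrow> zseq \<Rightarrow> real" where
  "pairing_functional N y = (\<lambda>x\<in>space_of N. \<Sum>\<^sub>\<infinity>n. x n * y n)"

text \<open>
  The dual of \<open>space_of N\<close> is \<open>space_of M\<close>: the pairing series converges absolutely, and
  \<open>y \<mapsto> (x \<mapsto> \<Sum>n. x n * y n)\<close> is a linear bijection of \<open>space_of M\<close> onto the dual space under
  which \<open>M\<close> and the dual norm are equivalent.
\<close>

definition dual_identified_with :: "(zseq \<Rightarrow> ennreal) \<Rightarrow> (zseq \<Rightarrow> ennreal) \<Rightarrow> bool" where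
  "dual_identified_with N M \<longleftrightarrow>
     (\<forall>x\<in>space_of N. \<forall>y\<in>space_of M. (\<lambda>n. \<bar>x n * y n\<bar>) summable_on UNIV) \<and>
     bij_betw (pairing_functional N) (space_of M) (dual_space N) \<and>
     (\<forall>y\<in>space_of M. \<forall>z\<in>space_of M. \<forall>a b. \<forall>x\<in>space_of N.
        pairing_functional N (\<lambda>n. a * y n + b * z n) x =
          a * pairing_functional N y x + b * pairing_functional N z x) \<and>
     (\<exists>c C::real. 0 < c \<and> 0 < C \<and>
        (\<forall>y\<in>space_of M. ennreal c * M y \<le> dual_norm N (pairing_functional N y) \<and>
                        dual_norm N (pairing_functional N y) \<le> ennreal C * M y))"

end

theory Submission imports Defs begin

text \<open>
  At scale \<open>0\<close> the intervals are single points, so that scale alone contributes the \<open>\<ell>\<^sup>1\<close> norm of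
  \<open>x\<close>; hence \<open>l1_norm x \<le> lpq1_norm p q x\<close> (\<open>l1_norm_le_lpq1_norm\<close>).  Conversely, the \<open>\<ell>\<^sup>p\<close> norm on
  an interval is at most the \<open>\<ell>\<^sup>1\<close> norm there (\<open>powr_norm_le_sum\<close>), and the intervals of one scale
  partition the integers.  So scale \<open>j\<close> contributes at most \<open>r ^ j * l1_norm x\<close> with
  \<open>r = 2 powr (1 / q - 1 / p)\<close>.  Since \<open>p < q\<close> gives \<open>r < 1\<close>, the geometric series bounds the
  whole norm by \<open>1 / (1 - r)\<close> times the \<open>\<ell>\<^sup>1\<close> norm (\<open>lpq1_norm_le_l1_norm\<close>).

  Everything about duals then follows from the case of \<open>\<ell>\<^sup>1\<close>.  Two norms that bound each other up
  to constants have the same bounded functionals and equivalent dual norms, so an identification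
  of the dual of one is an identification of the dual of the other
  (\<open>dual_identified_with_if_equivalent\<close>).  For \<open>\<ell>\<^sup>1\<close> itself, a bounded functional \<open>f\<close> is
  determined by its values on the unit sequences, because the finite truncations of \<open>x\<close> converge
  to \<open>x\<close> in norm (\<open>functional_has_sum\<close>); these values form the bounded sequence that represents
  \<open>f\<close>, and the pairing is an isometry (\<open>dual_norm_pairing_functional\<close>).
\<close>

section \<open>Sums with values in the extended nonnegative reals\<close>

lemma sum_le_infsum_ennreal:
  fixes f :: "'a \<Rightarrow> ennreal"
  assumes "finite F" and "F \<subseteq> A"
  shows "sum f F \<le> infsum f A"
  by (subst nonneg_infsum_complete) (use assms in \<open>auto intro!: SUP_upper\<close>)

lemma infsum_le_ennrealI:
  fixes f :: "'a \<Rightarrow> ennreal"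
  assumes "\<And>F. finite F \<Longrightarrow> F \<subseteq> A \<Longrightarrow> sum f F \<le> B"
  shows "infsum f A \<le> B"
  by (subst nonneg_infsum_complete) (use assms in \<open>auto intro!: SUP_least\<close>)

lemma infsum_cmult_ennreal:
  fixes f :: "'a \<Rightarrow> ennreal"
  shows "infsum (\<lambda>i. c * f i) A = c * infsum f A"
  by (simp add: nonneg_infsum_complete SUP_mult_left_ennreal sum_distrib_left)

section \<open>The norm of absolutely summable sequences\<close>

lemma l1_norm_eq_infsum:
  assumes "(\<lambda>n. \<bar>x n\<bar>) summable_on UNIV"
  shows "l1_norm x = ennreal (\<Sum>\<^sub>\<infinity>n. \<bar>x n\<bar>)"
  unfolding l1_norm_def
  by (subst infsum_nonneg_is_SUPREMUM_ennreal[OF assms])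
    (simp_all add: nonneg_infsum_complete)

lemma mem_space_of_l1_norm_iff:
  "x \<in> space_of l1_norm \<longleftrightarrow> (\<lambda>n. \<bar>x n\<bar>) summable_on UNIV"
proof
  assume x: "x \<in> space_of l1_norm"
  then obtain B where B: "0 \<le> B" "l1_norm x = ennreal B"
    by (cases "l1_norm x" rule: ennreal_cases) (auto simp: space_of_def)
  have "(\<Sum>n\<in>F. \<bar>x n\<bar>) \<le> B" if "finite F" for F
    using sum_le_infsum_ennreal[OF that subset_UNIV, of "\<lambda>n. ennreal \<bar>x n\<bar>"] B
    by (simp add: l1_norm_def)
  then show "(\<lambda>n. \<bar>x n\<bar>) summable_on UNIV"
    by (intro nonneg_bdd_above_summable_on) (auto intro!: bdd_aboveI)
qed (simp add: space_of_def l1_norm_eq_infsum)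

lemma l1_norm_scale: "l1_norm (\<lambda>n. a * x n) = ennreal \<bar>a\<bar> * l1_norm x"
  by (simp add: l1_norm_def abs_mult ennreal_mult infsum_cmult_ennreal)

section \<open>The dyadic block norm is equivalent to the norm of absolutely summable sequences\<close>

text \<open>The comparison of \<open>\<ell>\<^sup>p\<close> with \<open>\<ell>\<^sup>1\<close> on one block: with \<open>S\<close> the sum of the \<open>a l\<close>, each
  \<open>a l\<close> is at most \<open>S\<close>, so the sum of the \<open>a l powr p\<close> is at most \<open>S powr (p - 1)\<close> times \<open>S\<close>.\<close>

lemma powr_norm_le_sum:
  fixes a :: "'a \<Rightarrow> real"
  assumes fin: "finite F" and p: "1 \<le> p" and a: "\<And>l. l \<in> F \<Longrightarrow> 0 \<le> a l"
  shows "(\<Sum>l\<in>F. a l powr p) powr (1 / p) \<le> (\<Sum>l\<in>F. a l)"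
proof -
  define S where "S = (\<Sum>l\<in>F. a l)"
  have S: "0 \<le> S"
    unfolding S_def by (intro sum_nonneg a)
  have split: "t powr p = t * t powr (p - 1)" if "0 \<le> t" for t :: real
    using powr_add[of t 1 "p - 1"] that by simp
  have "(\<Sum>l\<in>F. a l powr p) \<le> (\<Sum>l\<in>F. a l * S powr (p - 1))"
  proof (rule sum_mono)
    fix l assume l: "l \<in> F"
    have "a l \<le> S"
      unfolding S_def using l fin a by (intro member_le_sum) auto
    then show "a l powr p \<le> a l * S powr (p - 1)"
      using p a[OF l] by (simp add: split mult_left_mono powr_mono2)
  qed
  also have "\<dots> = S * S powr (p - 1)"
    by (simp only: S_def sum_distrib_right)
  also have "\<dots> = S powr p"
    by (simp only: split[OF S])
  finally have "(\<Sum>l\<in>F. a l powr p) powr (1 / p) \<le> (S powr p) powr (1 / p)"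
    using p by (intro powr_mono2 sum_nonneg) auto
  also have "\<dots> = S"
    using p S by (simp add: powr_powr)
  finally show ?thesis
    by (simp add: S_def)
qed

lemma finite_dyadic [simp]: "finite (dyadic j k)"
  by (simp add: dyadic_def)

lemma mem_dyadic_iff: "n \<in> dyadic j k \<longleftrightarrow> k = n div 2 ^ j"
proof -
  define b :: int where "b = 2 ^ j"
  have b: "0 < b"
    by (simp add: b_def)
  have "k = n div b" if "b * k \<le> n" "n < b * (k + 1)"
    using that by (intro int_div_pos_eq[symmetric, of n b k "n - b * k"]) (auto simp: algebra_simps)
  moreover have "b * (n div b) \<le> n" "n < b * (n div b + 1)"
    using mult_div_mod_eq[of b n] pos_mod_sign[OF b, of n] pos_mod_bound[OF b, of n]
    by (simp_all only: distrib_left mult_1_right)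
  ultimately show ?thesis
    unfolding dyadic_def atLeastLessThan_iff b_def[symmetric] by blast
qed

lemma infsum_dyadic_le_l1_norm:
  "(\<Sum>\<^sub>\<infinity>k. ennreal (\<Sum>l\<in>dyadic j k. \<bar>x l\<bar>)) \<le> l1_norm x"
proof (rule infsum_le_ennrealI)
  fix F :: "int set" assume F: "finite F"
  have "(\<Sum>k\<in>F. ennreal (\<Sum>l\<in>dyadic j k. \<bar>x l\<bar>))
      = (\<Sum>l\<in>(\<Union>k\<in>F. dyadic j k). ennreal \<bar>x l\<bar>)"
    by (subst sum.UNION_disjoint) (use F in \<open>auto simp: mem_dyadic_iff\<close>)
  also have "\<dots> \<le> l1_norm x"
    unfolding l1_norm_def using F by (intro sum_le_infsum_ennreal) auto
  finally show "(\<Sum>k\<in>F. ennreal (\<Sum>l\<in>dyadic j k. \<bar>x l\<bar>)) \<le> l1_norm x" .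
qed

text \<open>Among all scales, \<open>j = 0\<close> suffices: there each block norm is \<open>\<bar>x k\<bar>\<close> and the weight is \<open>1\<close>.\<close>

lemma l1_norm_le_lpq1_norm:
  assumes "1 \<le> p"
  shows "l1_norm x \<le> lpq1_norm p q x"
proof -
  have sing: "dyadic 0 k = {k}" for k
    by (auto simp: dyadic_def)
  have "l1_norm x = (\<Sum>\<^sub>\<infinity>k. ennreal ((2 ^ 0) powr (1 / q - 1 / p)
      * (\<Sum>l\<in>dyadic 0 k. \<bar>x l\<bar> powr p) powr (1 / p)))"
    using assms by (simp add: l1_norm_def sing powr_powr)
  also have "\<dots> \<le> lpq1_norm p q x"
    unfolding lpq1_norm_def
    by (rule order_trans[OF _ sum_le_suminf[of _ "{0}"]]) auto
  finally show ?thesis .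
qed

lemma two_powr_less_one:
  fixes p q :: real
  assumes "1 \<le> p" and "p < q"
  shows "2 powr (1 / q - 1 / p) < (1 :: real)"
proof -
  have "1 / q < 1 / p"
    using assms by (simp add: frac_less2)
  then show ?thesis
    using powr_less_mono[of "1 / q - 1 / p" 0 2] by simp
qed

text \<open>Each scale \<open>j\<close> contributes at most \<open>2 powr (1 / q - 1 / p)\<close> to the power \<open>j\<close> times the
  \<open>\<ell>\<^sup>1\<close> norm, and the exponent is negative because \<open>p < q\<close>.\<close>

lemma lpq1_norm_le_l1_norm:
  assumes p: "1 \<le> p" and pq: "p < q"
  shows "lpq1_norm p q x \<le> ennreal (1 / (1 - 2 powr (1 / q - 1 / p))) * l1_norm x"
proof -
  define r :: real where "r = 2 powr (1 / q - 1 / p)"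
  have r: "0 < r" "r < 1"
    using two_powr_less_one[OF assms] by (simp_all add: r_def)
  have rj: "(2 ^ j) powr (1 / q - 1 / p) = r ^ j" for j
    by (simp add: r_def powr_power powr_powr mult.commute flip: powr_realpow)
  have "(\<Sum>\<^sub>\<infinity>k. ennreal ((2 ^ j) powr (1 / q - 1 / p)
      * (\<Sum>l\<in>dyadic j k. \<bar>x l\<bar> powr p) powr (1 / p))) \<le> ennreal (r ^ j) * l1_norm x" for j
  proof -
    have "(\<Sum>\<^sub>\<infinity>k. ennreal ((2 ^ j) powr (1 / q - 1 / p)
        * (\<Sum>l\<in>dyadic j k. \<bar>x l\<bar> powr p) powr (1 / p)))
      \<le> (\<Sum>\<^sub>\<infinity>k. ennreal (r ^ j) * ennreal (\<Sum>l\<in>dyadic j k. \<bar>x l\<bar>))"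
    proof (rule infsum_mono)
      fix k
      have "(\<Sum>l\<in>dyadic j k. \<bar>x l\<bar> powr p) powr (1 / p) \<le> (\<Sum>l\<in>dyadic j k. \<bar>x l\<bar>)"
        using p by (intro powr_norm_le_sum) auto
      then show "ennreal ((2 ^ j) powr (1 / q - 1 / p)
          * (\<Sum>l\<in>dyadic j k. \<bar>x l\<bar> powr p) powr (1 / p))
        \<le> ennreal (r ^ j) * ennreal (\<Sum>l\<in>dyadic j k. \<bar>x l\<bar>)"
        using r by (simp add: rj sum_nonneg mult_left_mono flip: ennreal_mult del: sum_ennreal)
    qed (intro nonneg_summable_on_complete zero_le)+
    also have "\<dots> \<le> ennreal (r ^ j) * l1_norm x"
      by (simp only: infsum_cmult_ennreal) (intro mult_left_mono infsum_dyadic_le_l1_norm zero_le)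
    finally show ?thesis .
  qed
  then have "lpq1_norm p q x \<le> (\<Sum>j. ennreal (r ^ j) * l1_norm x)"
    unfolding lpq1_norm_def by (intro suminf_le) auto
  also have "\<dots> = (\<Sum>j. ennreal (r ^ j)) * l1_norm x"
    by (rule ennreal_suminf_multc)
  also have "(\<Sum>j. ennreal (r ^ j)) = ennreal (1 / (1 - r))"
    using r by (intro suminf_ennreal_eq geometric_sums) auto
  finally show ?thesis
    by (simp add: r_def)
qed

section \<open>Equivalent norms have the same dual space\<close>

lemma space_of_eq_if_equivalent:
  assumes "\<And>x. M x \<le> N x" and "\<And>x. N x \<le> ennreal C * M x"
  shows "space_of N = space_of M"
proof -
  have "M x < \<infinity> \<longleftrightarrow> N x < \<infinity>" for x
    using assms[of x] by (auto simp: ennreal_mult_less_top intro: le_less_trans)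
  then show ?thesis
    by (simp add: space_of_def)
qed

lemma dual_space_eq_if_equivalent:
  assumes le: "\<And>x. M x \<le> N x" and ge: "\<And>x. N x \<le> ennreal C * M x" and C: "0 \<le> C"
  shows "dual_space N = dual_space M"
proof -
  have "(\<exists>K. \<forall>x\<in>S. ennreal \<bar>f x\<bar> \<le> ennreal K * N x) \<longleftrightarrow>
      (\<exists>K. \<forall>x\<in>S. ennreal \<bar>f x\<bar> \<le> ennreal K * M x)" (is "?N \<longleftrightarrow> ?M")
    for S and f :: "zseq \<Rightarrow> real"
  proof
    assume ?N
    then obtain K where K: "\<And>x. x \<in> S \<Longrightarrow> ennreal \<bar>f x\<bar> \<le> ennreal K * N x"
      by blast
    have "ennreal \<bar>f x\<bar> \<le> ennreal (K * C) * M x" if "x \<in> S" for x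
    proof -
      have "ennreal \<bar>f x\<bar> \<le> ennreal K * (ennreal C * M x)"
        using K[OF that] ge[of x] by (meson mult_left_mono order_trans zero_le)
      then show ?thesis
        using C by (simp add: ennreal_mult'' mult.assoc)
    qed
    then show ?M
      by blast
  next
    assume ?M
    then show ?N
      using le by (meson mult_left_mono order_trans zero_le)
  qed
  then show ?thesis
    by (simp add: dual_space_def space_of_eq_if_equivalent[OF le ge])
qed

lemma dual_space_add:
  assumes "f \<in> dual_space N" and "x \<in> space_of N" and "y \<in> space_of N"
  shows "f (\<lambda>n. x n + y n) = f x + f y"
  using assms unfolding dual_space_def by blast

lemma dual_space_scale:
  assumes "f \<in> dual_space N" and "x \<in> space_of N"
  shows "f (\<lambda>n. a * x n) = a * f x"
  using assms unfolding dual_space_def by blast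

lemma dual_norm_antimono:
  assumes "\<And>x. M x \<le> N x"
  shows "dual_norm N f \<le> dual_norm M f"
  unfolding dual_norm_def using assms by (intro SUP_subset_mono) (auto intro: order_trans)

text \<open>Dividing by \<open>C\<close> moves the unit ball of \<open>M\<close> into that of \<open>N\<close>.\<close>

lemma dual_norm_le_if_equivalent:
  assumes ge: "\<And>x. N x \<le> ennreal C * M x" and C: "0 < C"
    and hom: "\<And>a x. M (\<lambda>n. a * x n) = ennreal \<bar>a\<bar> * M x"
    and f: "f \<in> dual_space M"
  shows "dual_norm M f \<le> ennreal C * dual_norm N f"
proof -
  have "ennreal \<bar>f x\<bar> \<le> ennreal C * dual_norm N f" if x: "M x \<le> 1" for x
  proof -
    define z where "z = (\<lambda>n. (1 / C) * x n)"
    have "N z \<le> ennreal C * (ennreal (1 / C) * M x)"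
      using ge[of z] C hom[of "1 / C" x] by (simp only: z_def) simp
    also have "\<dots> = M x"
      using C by (simp add: mult.assoc[symmetric] flip: ennreal_mult')
    finally have z: "ennreal \<bar>f z\<bar> \<le> dual_norm N f"
      unfolding dual_norm_def using x by (intro SUP_upper) auto
    have "x \<in> space_of M"
      using x by (auto simp: space_of_def intro: le_less_trans)
    then have "f z = (1 / C) * f x"
      unfolding z_def by (rule dual_space_scale[OF f])
    then have "\<bar>f x\<bar> = C * \<bar>f z\<bar>"
      using C by (simp add: abs_mult)
    then have "ennreal \<bar>f x\<bar> = ennreal C * ennreal \<bar>f z\<bar>"
      using C by (simp add: ennreal_mult)
    then show ?thesis
      using z by (simp add: mult_left_mono)
  qed
  then show ?thesis
    unfolding dual_norm_def[of M] by (intro SUP_least) auto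
qed

lemma inverse_dual_norm_le_if_equivalent:
  assumes ge: "\<And>x. N x \<le> ennreal C * M x" and C: "0 < C"
    and hom: "\<And>a x. M (\<lambda>n. a * x n) = ennreal \<bar>a\<bar> * M x"
    and f: "f \<in> dual_space M"
  shows "ennreal (1 / C) * dual_norm M f \<le> dual_norm N f"
proof -
  have "ennreal (1 / C) * dual_norm M f \<le> ennreal (1 / C) * (ennreal C * dual_norm N f)"
    by (intro mult_left_mono dual_norm_le_if_equivalent[where C = C] assms zero_le)
  also have "\<dots> = dual_norm N f"
    using C by (simp add: mult.assoc[symmetric] flip: ennreal_mult')
  finally show ?thesis .
qed

lemma dual_identified_with_if_equivalent:
  assumes le: "\<And>x. M x \<le> N x" and ge: "\<And>x. N x \<le> ennreal C * M x" and C: "0 < C"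
    and hom: "\<And>a x. M (\<lambda>n. a * x n) = ennreal \<bar>a\<bar> * M x"
    and M: "dual_identified_with M P"
  shows "dual_identified_with N P"
proof -
  have sp: "space_of N = space_of M"
    by (rule space_of_eq_if_equivalent[OF le ge])
  have pf: "pairing_functional N = pairing_functional M"
    by (simp add: pairing_functional_def sp fun_eq_iff)
  have ds: "dual_space N = dual_space M"
    by (rule dual_space_eq_if_equivalent[OF le ge]) (use C in simp)
  obtain b B where bB: "0 < b" "0 < B"
    and P: "\<And>y. y \<in> space_of P \<Longrightarrow> ennreal b * P y \<le> dual_norm M (pairing_functional M y)"
      "\<And>y. y \<in> space_of P \<Longrightarrow> dual_norm M (pairing_functional M y) \<le> ennreal B * P y"
    using M unfolding dual_identified_with_def by blast
  have "ennreal (b / C) * P y \<le> dual_norm N (pairing_functional M y)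
      \<and> dual_norm N (pairing_functional M y) \<le> ennreal B * P y" if y: "y \<in> space_of P" for y
  proof
    have f: "pairing_functional M y \<in> dual_space M"
      using M y unfolding dual_identified_with_def bij_betw_def by blast
    have "ennreal (b / C) * P y = ennreal (1 / C) * (ennreal b * P y)"
      using bB C by (simp add: mult.assoc[symmetric] flip: ennreal_mult)
    also have "\<dots> \<le> ennreal (1 / C) * dual_norm M (pairing_functional M y)"
      by (intro mult_left_mono P(1) y zero_le)
    also have "\<dots> \<le> dual_norm N (pairing_functional M y)"
      by (rule inverse_dual_norm_le_if_equivalent[OF ge C hom f])
    finally show "ennreal (b / C) * P y \<le> dual_norm N (pairing_functional M y)" .
    show "dual_norm N (pairing_functional M y) \<le> ennreal B * P y"
      using dual_norm_antimono[OF le] P(2)[OF y] by (rule order_trans)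
  qed
  moreover have "0 < b / C"
    using bB C by simp
  ultimately have "\<exists>c B::real. 0 < c \<and> 0 < B \<and> (\<forall>y\<in>space_of P.
      ennreal c * P y \<le> dual_norm N (pairing_functional M y)
      \<and> dual_norm N (pairing_functional M y) \<le> ennreal B * P y)"
    using bB(2) by blast
  then show ?thesis
    using M unfolding dual_identified_with_def sp pf ds by blast
qed

section \<open>The dual of the space of absolutely summable sequences\<close>

lemma abs_le_of_linf_norm_le:
  assumes "linf_norm y \<le> ennreal B" and "0 \<le> B"
  shows "\<bar>y n\<bar> \<le> B"
proof -
  have "ennreal \<bar>y n\<bar> \<le> linf_norm y"
    unfolding linf_norm_def by (intro SUP_upper) simp
  then show ?thesis
    using assms by (meson ennreal_le_iff order_trans)
qed

lemma mem_space_of_linf_normE: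
  assumes "y \<in> space_of linf_norm"
  obtains B where "0 \<le> B" and "linf_norm y = ennreal B" and "\<And>n. \<bar>y n\<bar> \<le> B"
proof -
  obtain B where B: "0 \<le> B" "linf_norm y = ennreal B"
    using assms by (cases "linf_norm y" rule: ennreal_cases) (auto simp: space_of_def)
  then show ?thesis
    using that[OF B] abs_le_of_linf_norm_le[of y B] by simp
qed

lemma abs_summable_pairing:
  assumes x: "x \<in> space_of l1_norm" and y: "\<And>n. \<bar>y n\<bar> \<le> B"
  shows "(\<lambda>n. \<bar>x n * y n\<bar>) summable_on UNIV"
    and "\<bar>\<Sum>\<^sub>\<infinity>n. x n * y n\<bar> \<le> B * (\<Sum>\<^sub>\<infinity>n. \<bar>x n\<bar>)"
proof -
  have s: "(\<lambda>n. \<bar>x n\<bar>) summable_on UNIV"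
    using x by (simp add: mem_space_of_l1_norm_iff)
  then have sB: "(\<lambda>n. B * \<bar>x n\<bar>) summable_on UNIV"
    by (rule summable_on_cmult_right)
  have le: "\<bar>x n * y n\<bar> \<le> B * \<bar>x n\<bar>" for n
    using mult_right_mono[OF y[of n] abs_ge_zero[of "x n"]] by (simp add: abs_mult mult.commute)
  show xy: "(\<lambda>n. \<bar>x n * y n\<bar>) summable_on UNIV"
    by (rule summable_on_comparison_test[OF sB]) (use le in auto)
  have "\<bar>\<Sum>\<^sub>\<infinity>n. x n * y n\<bar> \<le> (\<Sum>\<^sub>\<infinity>n. \<bar>x n * y n\<bar>)"
    using norm_infsum_bound[of "\<lambda>n. x n * y n" UNIV] xy by simp
  also have "\<dots> \<le> (\<Sum>\<^sub>\<infinity>n. B * \<bar>x n\<bar>)"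
    by (rule infsum_mono[OF xy sB]) (rule le)
  also have "\<dots> = B * (\<Sum>\<^sub>\<infinity>n. \<bar>x n\<bar>)"
    by (rule infsum_cmult_right')
  finally show "\<bar>\<Sum>\<^sub>\<infinity>n. x n * y n\<bar> \<le> B * (\<Sum>\<^sub>\<infinity>n. \<bar>x n\<bar>)" .
qed

lemma summable_pairing:
  assumes "x \<in> space_of l1_norm" and "\<And>n. \<bar>y n\<bar> \<le> B"
  shows "(\<lambda>n. x n * y n) summable_on UNIV"
  by (rule abs_summable_summable) (use abs_summable_pairing(1)[OF assms] in simp)

lemma add_mem_space_of_l1_norm:
  assumes "x \<in> space_of l1_norm" and "y \<in> space_of l1_norm"
  shows "(\<lambda>n. x n + y n) \<in> space_of l1_norm"
proof -
  have "(\<lambda>n. \<bar>x n\<bar> + \<bar>y n\<bar>) summable_on UNIV"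
    using assms by (intro summable_on_add) (simp_all add: mem_space_of_l1_norm_iff)
  then have "(\<lambda>n. \<bar>x n + y n\<bar>) summable_on UNIV"
    by (rule summable_on_comparison_test) auto
  then show ?thesis
    by (simp add: mem_space_of_l1_norm_iff)
qed

lemma scale_mem_space_of_l1_norm:
  assumes "x \<in> space_of l1_norm"
  shows "(\<lambda>n. a * x n) \<in> space_of l1_norm"
  using assms by (simp add: mem_space_of_l1_norm_iff abs_mult summable_on_cmult_right)

lemma finite_support_mem_space_of_l1_norm:
  assumes "finite F"
  shows "(\<lambda>n. if n \<in> F then x n else 0) \<in> space_of l1_norm"
proof -
  have "(\<lambda>n. \<bar>if n \<in> F then x n else 0\<bar>) summable_on UNIV \<longleftrightarrow> (\<lambda>n. \<bar>x n\<bar>) summable_on F"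
    by (rule summable_on_cong_neutral) auto
  then show ?thesis
    using assms by (simp add: mem_space_of_l1_norm_iff)
qed

definition delta :: "int \<Rightarrow> zseq" where
  "delta m = (\<lambda>n. if n = m then 1 else 0)"

lemma delta_mem_space_of_l1_norm [simp]: "delta m \<in> space_of l1_norm"
  using finite_support_mem_space_of_l1_norm[of "{m}" "\<lambda>_. 1"] by (simp add: delta_def)

lemma infsum_delta: "(\<Sum>\<^sub>\<infinity>n. delta m n * y n) = y m"
proof -
  have "(\<Sum>\<^sub>\<infinity>n. delta m n * y n) = infsum y {m}"
    by (rule infsum_cong_neutral) (auto simp: delta_def)
  then show ?thesis
    by simp
qed

lemma l1_norm_delta: "l1_norm (delta m) = 1"
proof -
  have "(\<lambda>n. \<bar>delta m n\<bar>) = (\<lambda>n. delta m n * 1)"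
    by (auto simp: delta_def)
  then show ?thesis
    using infsum_delta[of m "\<lambda>_. 1"] delta_mem_space_of_l1_norm[of m]
    by (simp add: l1_norm_eq_infsum mem_space_of_l1_norm_iff)
qed

lemma pairing_functional_delta: "pairing_functional l1_norm y (delta m) = y m"
  by (simp add: pairing_functional_def infsum_delta)

text \<open>Testing on the sequences \<open>delta m\<close> gives one inequality, the termwise bound
  \<open>\<bar>x n * y n\<bar> \<le> B * \<bar>x n\<bar>\<close> the other.\<close>

lemma dual_norm_pairing_functional:
  assumes y: "y \<in> space_of linf_norm"
  shows "dual_norm l1_norm (pairing_functional l1_norm y) = linf_norm y"
proof (rule antisym)
  obtain B where B: "0 \<le> B" "linf_norm y = ennreal B" "\<And>n. \<bar>y n\<bar> \<le> B"
    using mem_space_of_linf_normE[OF y] by blast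
  have "ennreal \<bar>pairing_functional l1_norm y x\<bar> \<le> ennreal B" if x: "l1_norm x \<le> 1" for x
  proof -
    have xs: "x \<in> space_of l1_norm"
      using x by (auto simp: space_of_def intro: le_less_trans)
    then have "(\<Sum>\<^sub>\<infinity>n. \<bar>x n\<bar>) \<le> 1"
      using x by (simp add: l1_norm_eq_infsum mem_space_of_l1_norm_iff)
    then have "B * (\<Sum>\<^sub>\<infinity>n. \<bar>x n\<bar>) \<le> B"
      using B(1) by (simp add: mult_left_le)
    then show ?thesis
      using abs_summable_pairing(2)[OF xs, where y = y and B = B] B(3) xs B(1)
      by (simp add: pairing_functional_def ennreal_leI)
  qed
  then show "dual_norm l1_norm (pairing_functional l1_norm y) \<le> linf_norm y"
    unfolding dual_norm_def B(2) by (intro SUP_least) auto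
  show "linf_norm y \<le> dual_norm l1_norm (pairing_functional l1_norm y)"
    unfolding linf_norm_def
  proof (rule SUP_least)
    fix m
    have "ennreal \<bar>pairing_functional l1_norm y (delta m)\<bar>
        \<le> dual_norm l1_norm (pairing_functional l1_norm y)"
      unfolding dual_norm_def by (intro SUP_upper) (simp add: l1_norm_delta)
    then show "ennreal \<bar>y m\<bar> \<le> dual_norm l1_norm (pairing_functional l1_norm y)"
      by (simp add: pairing_functional_delta)
  qed
qed

lemma pairing_functional_linear:
  assumes y: "y \<in> space_of linf_norm" and z: "z \<in> space_of linf_norm"
    and x: "x \<in> space_of l1_norm"
  shows "pairing_functional l1_norm (\<lambda>n. a * y n + b * z n) x =
    a * pairing_functional l1_norm y x + b * pairing_functional l1_norm z x"
proof -
  have s: "(\<lambda>n. x n * w n) summable_on UNIV" if w: "w \<in> space_of linf_norm" for w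
    using w by (rule mem_space_of_linf_normE) (rule summable_pairing[OF x])
  have "(\<Sum>\<^sub>\<infinity>n. x n * (a * y n + b * z n)) = (\<Sum>\<^sub>\<infinity>n. a * (x n * y n) + b * (x n * z n))"
    by (simp add: algebra_simps)
  also have "\<dots> = a * (\<Sum>\<^sub>\<infinity>n. x n * y n) + b * (\<Sum>\<^sub>\<infinity>n. x n * z n)"
    using s[OF y] s[OF z] by (simp add: infsum_add summable_on_cmult_right infsum_cmult_right')
  finally show ?thesis
    using x by (simp add: pairing_functional_def)
qed

lemma pairing_functional_mem_dual_space:
  assumes y: "y \<in> space_of linf_norm"
  shows "pairing_functional l1_norm y \<in> dual_space l1_norm"
proof -
  obtain B where B: "0 \<le> B" "linf_norm y = ennreal B" "\<And>n. \<bar>y n\<bar> \<le> B"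
    using mem_space_of_linf_normE[OF y] by blast
  have sp: "(\<lambda>n. x n * y n) summable_on UNIV" if "x \<in> space_of l1_norm" for x
    using that B(3) by (rule summable_pairing)
  have "ennreal \<bar>pairing_functional l1_norm y x\<bar> \<le> ennreal B * l1_norm x"
    if x: "x \<in> space_of l1_norm" for x
  proof -
    have "l1_norm x = ennreal (\<Sum>\<^sub>\<infinity>n. \<bar>x n\<bar>)"
      using x by (simp add: l1_norm_eq_infsum mem_space_of_l1_norm_iff)
    then show ?thesis
      using abs_summable_pairing(2)[OF x, where y = y and B = B] B(3) x B(1)
      by (simp add: pairing_functional_def ennreal_leI infsum_nonneg flip: ennreal_mult)
  qed
  moreover have "pairing_functional l1_norm y (\<lambda>n. x n + z n)
      = pairing_functional l1_norm y x + pairing_functional l1_norm y z"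
    if "x \<in> space_of l1_norm" "z \<in> space_of l1_norm" for x z
    using that sp
    by (simp add: pairing_functional_def add_mem_space_of_l1_norm distrib_right infsum_add)
  moreover have "pairing_functional l1_norm y (\<lambda>n. a * x n) = a * pairing_functional l1_norm y x"
    if "x \<in> space_of l1_norm" for a x
    using that by (simp add: pairing_functional_def scale_mem_space_of_l1_norm mult.assoc
        infsum_cmult_right')
  moreover have "pairing_functional l1_norm y \<in> extensional (space_of l1_norm)"
    by (simp add: pairing_functional_def)
  ultimately show ?thesis
    unfolding dual_space_def by blast
qed

lemma functional_finite_support:
  assumes f: "f \<in> dual_space l1_norm" and "finite F"
  shows "f (\<lambda>n. if n \<in> F then x n else 0) = (\<Sum>m\<in>F. x m * f (delta m))"
  using \<open>finite F\<close>
proof (induction F rule: finite_induct)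
  case empty
  have "f (\<lambda>n. 0 * delta 0 n) = 0 * f (delta 0)"
    by (rule dual_space_scale[OF f delta_mem_space_of_l1_norm])
  then show ?case
    by simp
next
  case (insert m F)
  have "f (\<lambda>n. if n \<in> insert m F then x n else 0)
      = f (\<lambda>n. x m * delta m n + (if n \<in> F then x n else 0))"
    using insert.hyps by (intro arg_cong[of _ _ f]) (auto simp: delta_def)
  also have "\<dots> = f (\<lambda>n. x m * delta m n) + f (\<lambda>n. if n \<in> F then x n else 0)"
    by (rule dual_space_add[OF f scale_mem_space_of_l1_norm[OF delta_mem_space_of_l1_norm]
          finite_support_mem_space_of_l1_norm[OF insert.hyps(1)]])
  also have "f (\<lambda>n. x m * delta m n) = x m * f (delta m)"
    by (rule dual_space_scale[OF f delta_mem_space_of_l1_norm])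
  finally show ?case
    using insert by simp
qed

lemma bounded_functionalE:
  assumes f: "f \<in> dual_space l1_norm"
  obtains K where "\<And>x. x \<in> space_of l1_norm \<Longrightarrow> \<bar>f x\<bar> \<le> K * (\<Sum>\<^sub>\<infinity>n. \<bar>x n\<bar>)"
proof -
  obtain K where K: "\<And>x. x \<in> space_of l1_norm \<Longrightarrow> ennreal \<bar>f x\<bar> \<le> ennreal K * l1_norm x"
    using f unfolding dual_space_def by blast
  \<comment> \<open>A negative \<open>K\<close> is possible: then \<open>ennreal K = 0\<close> and the bound says that \<open>f\<close> vanishes.\<close>
  have "\<bar>f x\<bar> \<le> max 0 K * (\<Sum>\<^sub>\<infinity>n. \<bar>x n\<bar>)" if x: "x \<in> space_of l1_norm" for x
  proof -
    have "ennreal \<bar>f x\<bar> \<le> ennreal (max 0 K) * l1_norm x"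
      using K[OF x] by (cases "0 \<le> K") (simp_all add: max_def ennreal_neg)
    then show ?thesis
      using x by (simp add: l1_norm_eq_infsum mem_space_of_l1_norm_iff infsum_nonneg
          flip: ennreal_mult)
  qed
  then show ?thesis
    using that by blast
qed

text \<open>A bounded functional differs from its finite partial sums by its value on a tail of \<open>x\<close>, and
  the norm of that tail is the difference between the full sum of \<open>\<bar>x n\<bar>\<close> and a partial sum.\<close>

lemma functional_has_sum:
  assumes f: "f \<in> dual_space l1_norm" and x: "x \<in> space_of l1_norm"
  shows "((\<lambda>n. x n * f (delta n)) has_sum f x) UNIV"
proof -
  obtain K where K: "\<And>x. x \<in> space_of l1_norm \<Longrightarrow> \<bar>f x\<bar> \<le> K * (\<Sum>\<^sub>\<infinity>n. \<bar>x n\<bar>)"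
    using bounded_functionalE[OF f] by blast
  have s: "(\<lambda>n. \<bar>x n\<bar>) summable_on UNIV"
    using x by (simp add: mem_space_of_l1_norm_iff)
  define L where "L = (\<Sum>\<^sub>\<infinity>n. \<bar>x n\<bar>)"
  have bound: "norm ((\<Sum>n\<in>F. x n * f (delta n)) - f x) \<le> K * (L - (\<Sum>n\<in>F. \<bar>x n\<bar>))"
    if F: "finite F" for F
  proof -
    define h where "h = (\<lambda>n. if n \<in> F then x n else 0)"
    define t where "t = (\<lambda>n. if n \<in> F then 0 else x n)"
    have h: "h \<in> space_of l1_norm"
      unfolding h_def by (rule finite_support_mem_space_of_l1_norm[OF F])
    have "t = (\<lambda>n. x n + (- 1) * h n)"
      by (auto simp: t_def h_def)
    then have t: "t \<in> space_of l1_norm"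
      using x h by (simp only: add_mem_space_of_l1_norm scale_mem_space_of_l1_norm)
    have "x = (\<lambda>n. h n + t n)"
      by (auto simp: t_def h_def)
    then have "f x = f h + f t"
      using f h t unfolding dual_space_def by blast
    then have "norm ((\<Sum>n\<in>F. x n * f (delta n)) - f x) = \<bar>f t\<bar>"
      using functional_finite_support[OF f F, of x] by (simp add: h_def)
    also have "\<dots> \<le> K * (\<Sum>\<^sub>\<infinity>n. \<bar>t n\<bar>)"
      by (rule K[OF t])
    also have "(\<Sum>\<^sub>\<infinity>n. \<bar>t n\<bar>) = (\<Sum>\<^sub>\<infinity>n\<in>UNIV - F. \<bar>x n\<bar>)"
      by (rule infsum_cong_neutral) (auto simp: t_def)
    also have "\<dots> = L - (\<Sum>n\<in>F. \<bar>x n\<bar>)"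
      using infsum_Diff[OF s, of F] F by (simp add: L_def)
    finally show ?thesis .
  qed
  have "((\<lambda>F. \<Sum>n\<in>F. \<bar>x n\<bar>) \<longlongrightarrow> L) (finite_subsets_at_top UNIV)"
    unfolding L_def by (rule infsum_tendsto[OF s])
  then have "((\<lambda>F. K * (L - (\<Sum>n\<in>F. \<bar>x n\<bar>))) \<longlongrightarrow> K * (L - L)) (finite_subsets_at_top UNIV)"
    by (intro tendsto_intros)
  then have lim: "((\<lambda>F. K * (L - (\<Sum>n\<in>F. \<bar>x n\<bar>))) \<longlongrightarrow> 0) (finite_subsets_at_top UNIV)"
    by simp
  have "\<forall>\<^sub>F F in finite_subsets_at_top UNIV.
      norm ((\<Sum>n\<in>F. x n * f (delta n)) - f x) \<le> norm (K * (L - (\<Sum>n\<in>F. \<bar>x n\<bar>))) * 1"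
  proof (rule eventually_finite_subsets_at_top_weakI)
    fix F :: "int set" assume "finite F"
    then show "norm ((\<Sum>n\<in>F. x n * f (delta n)) - f x) \<le> norm (K * (L - (\<Sum>n\<in>F. \<bar>x n\<bar>))) * 1"
      using bound[of F] by simp
  qed
  with lim have "((\<lambda>F. (\<Sum>n\<in>F. x n * f (delta n)) - f x) \<longlongrightarrow> 0) (finite_subsets_at_top UNIV)"
    by (rule tendsto_0_le)
  then show ?thesis
    unfolding has_sum_def by (simp add: LIM_zero_iff)
qed

lemma bij_betw_pairing_functional:
  "bij_betw (pairing_functional l1_norm) (space_of linf_norm) (dual_space l1_norm)"
  unfolding bij_betw_def
proof (intro conjI equalityI subsetI)
  show "inj_on (pairing_functional l1_norm) (space_of linf_norm)"
    by (rule inj_onI) (metis ext pairing_functional_delta)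
next
  fix f assume "f \<in> pairing_functional l1_norm ` space_of linf_norm"
  then show "f \<in> dual_space l1_norm"
    by (auto intro: pairing_functional_mem_dual_space)
next
  fix f assume f: "f \<in> dual_space l1_norm"
  define y where "y = (\<lambda>n. f (delta n))"
  obtain K where K: "\<And>x. x \<in> space_of l1_norm \<Longrightarrow> \<bar>f x\<bar> \<le> K * (\<Sum>\<^sub>\<infinity>n. \<bar>x n\<bar>)"
    using bounded_functionalE[OF f] by blast
  have "(\<Sum>\<^sub>\<infinity>n. \<bar>delta m n\<bar>) = 1" for m
    using infsum_delta[of m "\<lambda>_. 1"]
    by (subst infsum_cong[where g = "\<lambda>n. delta m n * 1"]) (auto simp: delta_def)
  then have "\<bar>y m\<bar> \<le> K" for m
    using K[OF delta_mem_space_of_l1_norm[of m]] by (simp add: y_def)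
  then have "linf_norm y \<le> ennreal K"
    unfolding linf_norm_def by (intro SUP_least ennreal_leI)
  then have y: "y \<in> space_of linf_norm"
    by (auto simp: space_of_def intro: le_less_trans)
  have "pairing_functional l1_norm y = f"
  proof (rule extensionalityI[of _ "space_of l1_norm"])
    show "f \<in> extensional (space_of l1_norm)"
      using f by (simp add: dual_space_def)
    fix x assume x: "x \<in> space_of l1_norm"
    then show "pairing_functional l1_norm y x = f x"
      using infsumI[OF functional_has_sum[OF f x]] by (simp add: pairing_functional_def y_def)
  qed (simp add: pairing_functional_def)
  then show "f \<in> pairing_functional l1_norm ` space_of linf_norm"
    using y by blast
qed

lemma dual_l1_identified_with_linf: "dual_identified_with l1_norm linf_norm"
proof -
  have "(\<lambda>n. \<bar>x n * y n\<bar>) summable_on UNIV"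
    if x: "x \<in> space_of l1_norm" and y: "y \<in> space_of linf_norm" for x y
    using y by (rule mem_space_of_linf_normE) (rule abs_summable_pairing(1)[OF x])
  moreover have "ennreal 1 * linf_norm y \<le> dual_norm l1_norm (pairing_functional l1_norm y) \<and>
      dual_norm l1_norm (pairing_functional l1_norm y) \<le> ennreal 1 * linf_norm y"
    if "y \<in> space_of linf_norm" for y
    using that by (simp add: dual_norm_pairing_functional)
  ultimately show ?thesis
    unfolding dual_identified_with_def
    using bij_betw_pairing_functional pairing_functional_linear zero_less_one by blast
qed

section \<open>The dyadic block spaces\<close>

theorem corollary4p4p2:
  fixes p q :: real
  assumes "1 \<le> p" and "p < q"
  shows "eq_with_equiv_norms (space_of (lpq1_norm p q)) (lpq1_norm p q) (space_of l1_norm) l1_norm \<and>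
    eq_with_equiv_norms (dual_space (lpq1_norm p q)) (dual_norm (lpq1_norm p q))
      (dual_space l1_norm) (dual_norm l1_norm) \<and>
    dual_identified_with (lpq1_norm p q) linf_norm \<and>
    dual_identified_with l1_norm linf_norm"
proof -
  define C where "C = 1 / (1 - 2 powr (1 / q - 1 / p))"
  have C: "0 < C"
    using two_powr_less_one[OF assms] by (simp add: C_def)
  have le: "l1_norm x \<le> lpq1_norm p q x" for x
    using assms(1) by (rule l1_norm_le_lpq1_norm)
  have ge: "lpq1_norm p q x \<le> ennreal C * l1_norm x" for x
    unfolding C_def using assms by (rule lpq1_norm_le_l1_norm)
  have ds: "dual_space (lpq1_norm p q) = dual_space l1_norm"
    by (rule dual_space_eq_if_equivalent[OF le ge]) (use C in simp)
  have "eq_with_equiv_norms (space_of (lpq1_norm p q)) (lpq1_norm p q) (space_of l1_norm) l1_norm"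
    unfolding eq_with_equiv_norms_def
    using space_of_eq_if_equivalent[OF le ge] C le ge
    by (intro conjI exI[of _ 1] exI[of _ C]) auto
  moreover have "eq_with_equiv_norms (dual_space (lpq1_norm p q)) (dual_norm (lpq1_norm p q))
      (dual_space l1_norm) (dual_norm l1_norm)"
    unfolding eq_with_equiv_norms_def ds
    using inverse_dual_norm_le_if_equivalent[where M = l1_norm, OF ge C l1_norm_scale]
      dual_norm_antimono[of l1_norm, OF le] C
    by (intro conjI exI[of _ "1 / C"] exI[of _ 1]) auto
  moreover have "dual_identified_with (lpq1_norm p q) linf_norm"
    by (rule dual_identified_with_if_equivalent[where M = l1_norm, OF le ge C l1_norm_scale
          dual_l1_identified_with_linf])
  ultimately show ?thesis
    using dual_l1_identified_with_linf by blast
qed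

end
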